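(* Let $K$ be a field of characteristic $0$, let $l,d$ be positive integers, $a_1(z),\dots,a_l(z)\in K[z]\setminus\{0\}$, $b_1(z),\dots,b_d(z)\in K[z]$, and put $a(z)=a_1(z)\cdots a_l(z)$. For $1\le j\le d$ put $D_j=-a(z)\partial_z+b_j(z)\in K[z,\partial_z]$ and $w_j=\max\{\deg a-2,\deg b_j-1\}$, and assume $w_j\ge 0$ and that $D_j$ satisfies condition (C) below. For each $j$ let $f_{j,0}(z),\dots,f_{j,w_j}(z)\in (1/z)K[[1/z]]$ be linearly independent over $K$ with $D_j\cdot f_{j,u_j}(z)\in K[z]$ for $0\le u_j\le w_j$. Let $(n_1,\dots,n_d)$ be positive integers and, for $1\le j\le d$, let $\vec r_j=(r_{j,1},\dots,r_{j,l})$ be an $l$-tuple of nonnegative integers; put $R_{j,n_j}=R_{D_j,n_j,\vec r_j}$ (weighted Rodrigues operator, defined below). Assume $R_{j_1,n_{j_1}}R_{j_2,n_{j_2}}=R_{j_2,n_{j_2}}R_{j_1,n_{j_1}}$ in $K(z)[\partial_z]$ for all $1\le j_1,j_2\le d$. Let $F(z)$ be a nonzero polynomial in the ideal of $K[z]$ generated by $\prod_{v=1}^l a_v(z)^{\sum_{j=1}^d r_{j,v}}$, and put $$P(z)=\Big(\prod_{j=1}^d R_{j,n_j}\Big)\cdot F(z)\in K[z],\qquad Q_{j,u_j}(z)=\varphi_{f_{j,u_j}}\!\left(\frac{P(z)-P(t)}{z-t}\right)\quad(1\le j\le d,\ 0\le u_j\le w_j).$$ Assume $P(z)\neq 0$.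 Then for every $1\le j\le d$ and $0\le u_j\le w_j$, $$\mathrm{ord}_\infty\big(P(z)f_{j,u_j}(z)-Q_{j,u_j}(z)\big)\ge n_j+1,$$ i.e. $(P,Q_{j,u_j})_{j,u_j}$ is a Padé-type approximant of weight $(\boldsymbol n_1,\dots,\boldsymbol n_d)$, $\boldsymbol n_j=(n_j,\dots,n_j)\in\mathbb{N}^{w_j+1}$, of $(f_{j,u_j})_{1\le j\le d,\,0\le u_j\le w_j}$.
   Context: $K[[1/z]]$ is the ring of formal power series in $1/z$ over $K$ and $K((1/z))$ its fraction field; for $g=\sum_k a_k z^{-k}\in K((1/z))$, $\mathrm{ord}_\infty g=\min\{k: a_k\neq 0\}$ ($=\infty$ iff $g=0$). For $f(z)=\sum_{k\ge0} f_k/z^{k+1}\in (1/z)K[[1/z]]$, $\varphi_f:K[t]\to K$ is the $K$-linear map $t^k\mapsto f_k$, extended $K[z]$-linearly to $K[z,t]\to K[z]$. Differential operators act on $K((1/z))$ and on rational functions in the usual way, $\partial_z=d/dz$. Condition (C) for $D=-a(z)\partial_z+b(z)$ with $a(z)=\sum_{i=0}^{u}a_iz^i$ of degree $u$ and $b(z)=\sum_{i=0}^{v}b_iz^i$ of degree $v$: if $u-2=v-1$ then $a_u(k+u)+b_v\neq 0$ for all integers $k\ge 0$. Weighted Rodrigues operator: for $D=-a(z)\partial_z+b(z)$ with $a=a_1\cdots a_l$, $n\ge1$ and $\vec r=(r_1,\dots,r_l)$ nonnegative integers, $R_{D,n,\vec r}=\frac{1}{n!}\left(\partial_z+\frac{b(z)}{a(z)}\right)^n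 a(z)^n\prod_{v=1}^l a_v(z)^{-r_v}\in K(z)[\partial_z]$ (composition of operators; multiplication by functions as operators). *)

theory Defs
  imports "HOL-Computational_Algebra.Computational_Algebra" "HOL-Library.Extended"
begin

text \<open>
  An element \<open>\<Sum>k. c k / z ^ k\<close> of \<open>K((1/z))\<close> is represented by the formal Laurent series
  \<open>g :: 'a fls\<close> with \<open>fls_nth g k = c k\<close>; thus \<open>fls_X\<close> is \<open>1/z\<close> and \<open>fls_X_inv\<close> is \<open>z\<close>.
  The field \<open>K(z)\<close> is \<open>'a poly fract\<close>.
\<close>

definition poly_to_lser :: "'a::field poly \<Rightarrow> 'a fls" where
  "poly_to_lser p = poly (map_poly fls_const p) fls_X_inv"

definition zinv_fps :: "'a::field fls set" where
  "zinv_fps = range (\<lambda>h :: 'a fps. fls_X * fps_to_fls h)"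

definition ord_inf :: "'a::field fls \<Rightarrow> int extended" where
  "ord_inf g = (if g = 0 then Pinf else Fin (fls_subdegree g))"

text \<open>With \<open>x = 1/z\<close> one has \<open>d/dz = - x\<^sup>2 d/dx\<close>.\<close>

definition lser_dz :: "'a::field fls \<Rightarrow> 'a fls" where
  "lser_dz g = - (fls_X ^ 2) * fls_deriv g"

text \<open>The action of \<open>- a \<partial>\<^sub>z + b\<close> on \<open>K((1/z))\<close>.\<close>

definition lser_D :: "'a::field poly \<Rightarrow> 'a poly \<Rightarrow> 'a fls \<Rightarrow> 'a fls" where
  "lser_D a b g = - poly_to_lser a * lser_dz g + poly_to_lser b * g"

definition D_weight :: "'a::field poly \<Rightarrow> 'a poly \<Rightarrow> int" where
  "D_weight a b = max (int (degree a) - 2) (int (degree b) - 1)"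

definition condition_C :: "'a::field poly \<Rightarrow> 'a poly \<Rightarrow> bool" where
  "condition_C a b \<longleftrightarrow>
     (int (degree a) - 2 = int (degree b) - 1 \<longrightarrow>
       (\<forall>k::nat. lead_coeff a * of_nat (k + degree a) + lead_coeff b \<noteq> 0))"

text \<open>
  Elements of \<open>K(z)[\<partial>\<^sub>z]\<close> are taken as operators on \<open>K(z)\<close> (in characteristic \<open>0\<close> this
  representation is faithful), so the product is composition.
\<close>

definition fract_deriv :: "'a::field poly fract \<Rightarrow> 'a poly fract" where
  "fract_deriv x =
     (let (p, q) = (SOME (p, q). q \<noteq> 0 \<and> x = Fract p q)
      in Fract (pderiv p * q - p * pderiv q) (q ^ 2))"

text \<open>The quotient rule holds for every representation, so the choice above is immaterial.\<close>

lemma fract_deriv_Fract: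
  fixes p q :: "'a::field poly"
  assumes "q \<noteq> 0"
  shows "fract_deriv (Fract p q) = Fract (pderiv p * q - p * pderiv q) (q ^ 2)"
proof -
  define x where "x = (SOME (r, s). s \<noteq> 0 \<and> Fract p q = Fract r s)"
  obtain r s where x: "x = (r, s)" by (cases x)
  have "case x of (r, s) \<Rightarrow> s \<noteq> 0 \<and> Fract p q = Fract r s"
    unfolding x_def by (rule someI[of _ "(p, q)"]) (use assms in simp)
  then have s: "s \<noteq> 0" and eq: "p * s = r * q"
    using assms x by (auto simp: eq_fract)
  have "pderiv (p * s) = pderiv (r * q)" using eq by simp
  then have d: "p * pderiv s + s * pderiv p = r * pderiv q + q * pderiv r"
    by (simp add: pderiv_mult)
  have "(pderiv r * s - r * pderiv s) * q ^ 2 = (pderiv p * q - p * pderiv q) * s ^ 2"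
    using eq d by algebra
  then have "Fract (pderiv r * s - r * pderiv s) (s ^ 2)
      = Fract (pderiv p * q - p * pderiv q) (q ^ 2)"
    using assms s by (simp add: eq_fract)
  then show ?thesis
    using x unfolding fract_deriv_def x_def by simp
qed

definition mult_op :: "'a::field poly fract \<Rightarrow> 'a poly fract \<Rightarrow> 'a poly fract" where
  "mult_op h = (\<lambda>g. h * g)"

definition rodrigues_op ::
  "nat \<Rightarrow> (nat \<Rightarrow> 'a::field poly) \<Rightarrow> 'a poly \<Rightarrow> nat \<Rightarrow> (nat \<Rightarrow> nat) \<Rightarrow>
     'a poly fract \<Rightarrow> 'a poly fract" where
  "rodrigues_op l as b n r =
     (let a = (\<Prod>v=1..l. as v) in
       mult_op (1 / of_nat (fact n))
       \<circ> ((\<lambda>g. fract_deriv g + mult_op (to_fract b / to_fract a) g) ^^ n)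
       \<circ> mult_op (to_fract a ^ n)
       \<circ> mult_op (\<Prod>v=1..l. to_fract (as v) powi (- int (r v))))"

text \<open>The product \<open>T 1 \<circ> T 2 \<circ> \<dots> \<circ> T d\<close>.\<close>

definition op_prod :: "nat \<Rightarrow> (nat \<Rightarrow> 'b \<Rightarrow> 'b) \<Rightarrow> 'b \<Rightarrow> 'b" where
  "op_prod d T = foldr (\<circ>) (map T [1..<Suc d]) id"

text \<open>
  \<open>K[z,t]\<close> is \<open>'a poly poly\<close> with outer variable \<open>t\<close> and coefficients in \<open>K[z]\<close>. The map \<open>phi f\<close>
  is the \<open>K[z]\<close>-linear map with \<open>t ^ k \<mapsto> f\<^sub>k\<close>, where \<open>f\<^sub>k\<close> is the coefficient of \<open>1 / z ^ (k + 1)\<close>.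
\<close>

definition phi :: "'a::field fls \<Rightarrow> 'a poly poly \<Rightarrow> 'a poly" where
  "phi f p = (\<Sum>k\<le>degree p. smult (fls_nth f (int k + 1)) (coeff p k))"

text \<open>
  \<open>(P(z) - P(t)) / (z - t)\<close>: here \<open>[:P:]\<close> is \<open>P(z)\<close>, \<open>map_poly (\<lambda>c. [:c:]) P\<close> is \<open>P(t)\<close> and
  \<open>[:[:0, 1:], -1:]\<close> is \<open>z - t\<close>. The division is exact.
\<close>

definition diff_quot :: "'a::field poly \<Rightarrow> 'a poly poly" where
  "diff_quot P = ([:P:] - map_poly (\<lambda>c. [:c:]) P) div [:[:0, 1:], -1:]"

lemma diff_quot_exact:
  fixes P :: "'a::field poly"
  shows "[:[:0, 1:], -1:] * diff_quot P = [:P:] - map_poly (\<lambda>c. [:c:]) P"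
proof -
  let ?N = "[:P:] - map_poly (\<lambda>c. [:c:]) P"
  have "poly (map_poly (\<lambda>c. [:c:]) P) [:0, 1:] = P"
    by (induction P) (auto simp: map_poly_pCons)
  then have "poly ?N [:0, 1:] = 0" by simp
  then have "[:- [:0, 1:], 1:] dvd ?N" by (simp only: poly_eq_0_iff_dvd)
  moreover have "[:- [:0, 1:], 1:] = - [:[:0, 1 :: 'a:], -1:]" by simp
  ultimately have "[:[:0, 1:], -1:] dvd ?N" by (metis minus_dvd_iff)
  then show ?thesis unfolding diff_quot_def by (rule dvd_mult_div_cancel)
qed

definition pade_type_approximant ::
  "'i set \<Rightarrow> ('i \<Rightarrow> nat) \<Rightarrow> ('i \<Rightarrow> 'a::field fls) \<Rightarrow> 'a poly \<Rightarrow> ('i \<Rightarrow> 'a poly) \<Rightarrow> bool" where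
  "pade_type_approximant I n f P Q \<longleftrightarrow>
     P \<noteq> 0 \<and>
     (\<forall>i\<in>I. ord_inf (poly_to_lser P * f i - poly_to_lser (Q i)) \<ge> Fin (int (n i) + 1))"

end

theory Submission
  imports Defs
begin

text \<open>
  Write \<open>E = \<partial> + b/a\<close>. The coefficient of \<open>1 / z ^ (k + 1)\<close> in \<open>P f\<close> is the residue of \<open>z ^ k P f\<close>,
  and since \<open>D f\<close> is a polynomial, integration by parts shows that the residue of \<open>E (a g) f\<close>
  vanishes for every polynomial \<open>g\<close>. By commutativity \<open>P = R\<^sub>j q\<close> for each \<open>j\<close>, with \<open>q\<close> divisible by
  \<open>\<Prod>v. a\<^sub>v ^ r\<^sub>j\<^sub>v\<close>, so \<open>P\<close> lies in \<open>E ^ n\<^sub>j a ^ n\<^sub>j K[z]\<close>; this gives \<open>z ^ k P \<in> E (a K[z])\<close> for \<open>k < n\<^sub>j\<close>.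
\<close>

section \<open>Polynomials and the derivation d/dz inside K((1/z))\<close>

lemma poly_to_lser_0 [simp]: "poly_to_lser 0 = 0"
  by (simp add: poly_to_lser_def)

lemma poly_to_lser_pCons:
  "poly_to_lser (pCons c p) = fls_const c + fls_X_inv * poly_to_lser p"
  by (simp add: poly_to_lser_def map_poly_pCons)

lemma poly_to_lser_add: "poly_to_lser (p + q) = poly_to_lser p + poly_to_lser q"
  by (induction p q rule: poly_induct2)
    (simp_all add: poly_to_lser_pCons algebra_simps flip: fls_plus_const)

lemma poly_to_lser_smult: "poly_to_lser (smult c p) = fls_const c * poly_to_lser p"
  by (induction p) (simp_all add: poly_to_lser_pCons algebra_simps flip: fls_const_mult_const)

lemma poly_to_lser_mult: "poly_to_lser (p * q) = poly_to_lser p * poly_to_lser q"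
  by (induction p)
    (simp_all add: poly_to_lser_pCons poly_to_lser_add poly_to_lser_smult algebra_simps)

lemma lser_dz_add: "lser_dz (g + h) = lser_dz g + lser_dz h"
  by (simp add: lser_dz_def algebra_simps)

lemma lser_dz_mult: "lser_dz (g * h) = lser_dz g * h + g * lser_dz h"
  by (simp add: lser_dz_def algebra_simps)

lemma lser_dz_X_inv: "lser_dz fls_X_inv = 1"
  by (simp add: lser_dz_def fls_X_power_times_conv_shift fls_X_inv_power_conv_shift_1)

lemma lser_dz_poly: "lser_dz (poly_to_lser p) = poly_to_lser (pderiv p)"
proof (induction p)
  case 0
  then show ?case by (simp add: lser_dz_def)
next
  case (pCons c p)
  have "lser_dz (fls_const c) = 0" by (simp add: lser_dz_def)
  then show ?case
    using pCons
    by (simp add: poly_to_lser_pCons lser_dz_add lser_dz_mult lser_dz_X_inv pderiv_pCons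
        poly_to_lser_add)
qed

text \<open>A derivative has no residue: in x = 1/z, the factor x^2 moves the coefficient of
  \<open>fls_deriv g\<close> at x^(-1) to x^1, and that coefficient carries the factor 0.\<close>

lemma lser_dz_nth_1: "fls_nth (lser_dz g) 1 = 0"
  by (simp add: lser_dz_def fls_X_power_times_conv_shift)

lemma fls_nth_X_inv_mult: "fls_nth (fls_X_inv * g :: 'a::field fls) k = fls_nth g (k + 1)"
  by (simp add: fls_X_inv_times_conv_shift)

lemma poly_to_lser_nth_pos: "k > 0 \<Longrightarrow> fls_nth (poly_to_lser p) k = 0"
  by (induction p arbitrary: k) (simp_all add: poly_to_lser_pCons fls_nth_X_inv_mult)

text \<open>Integration by parts: ((ag)' + bg) f = (agf)' + g (-af' + bf). The first summand is a
  derivative, the second a polynomial, so neither has a residue.\<close>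

lemma residue_eq_0:
  assumes "lser_D a b f \<in> range poly_to_lser"
  shows "fls_nth (poly_to_lser (pderiv (a * g) + b * g) * f) 1 = 0"
proof -
  obtain q where q: "lser_D a b f = poly_to_lser q"
    using assms by blast
  have "poly_to_lser (pderiv (a * g) + b * g) * f
      = lser_dz (poly_to_lser (a * g) * f) + poly_to_lser g * lser_D a b f"
    by (simp add: lser_D_def lser_dz_mult lser_dz_poly poly_to_lser_mult poly_to_lser_add
        pderiv_mult algebra_simps)
  also have "poly_to_lser g * lser_D a b f = poly_to_lser (g * q)"
    by (simp add: q poly_to_lser_mult)
  finally show ?thesis
    by (simp add: lser_dz_nth_1 poly_to_lser_nth_pos)
qed

lemma fls_nth_X_power_poly_mult:
  "fls_nth (poly_to_lser ([:0, 1:] ^ k * p) * f) m = fls_nth (poly_to_lser p * f) (m + int k)"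
  by (induction k arbitrary: m)
    (simp_all add: poly_to_lser_pCons mult.assoc fls_nth_X_inv_mult add_ac)

section \<open>The remainder P f - Q and its order at infinity\<close>

lemma phi_eq_sum:
  assumes "degree p \<le> N"
  shows "phi f p = (\<Sum>k\<le>N. smult (fls_nth f (int k + 1)) (coeff p k))"
  unfolding phi_def
  by (rule sum.mono_neutral_left) (use assms in \<open>auto simp: coeff_eq_0\<close>)

text \<open>Multiplication by t shifts the moments of f by one, that is, replaces f by z f. Since
  \<open>phi\<close> reads only positive indices, g may differ from z f elsewhere, which permits
  removing the constant term.\<close>

lemma phi_pCons:
  assumes "\<And>k. k \<ge> 1 \<Longrightarrow> fls_nth g k = fls_nth f (k + 1)"
  shows "phi f (pCons c p) = smult (fls_nth f 1) c + phi g p"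
proof -
  have "phi f (pCons c p)
      = (\<Sum>k\<le>Suc (degree p). smult (fls_nth f (int k + 1)) (coeff (pCons c p) k))"
    by (rule phi_eq_sum) (simp add: degree_pCons_le)
  also have "\<dots> = smult (fls_nth f 1) c
      + (\<Sum>k\<le>degree p. smult (fls_nth f (int k + 1 + 1)) (coeff p k))"
    by (subst sum.atMost_Suc_shift) (simp add: add_ac)
  also have "(\<Sum>k\<le>degree p. smult (fls_nth f (int k + 1 + 1)) (coeff p k)) = phi g p"
    unfolding phi_def by (intro sum.cong refl) (simp add: assms)
  finally show ?thesis .
qed

lemma diff_quot_pCons: "diff_quot (pCons c P) = pCons P (diff_quot P)"
proof -
  \<comment> \<open>The outer \<open>pCons\<close> is in t, so this checks (z P(z) - t P(t)) / (z -
    t) = P(z) + t (P(z) - P(t)) / (z - t) after clearing the denominator; the constant c drops out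
    of the difference.\<close>
  have "[:[:0, 1:], -1:] * pCons P (diff_quot P)
      = [:[:0, 1:] * P:] + pCons 0 ([:[:0, 1:], -1:] * diff_quot P - [:P:])"
    by (simp add: algebra_simps)
  also have "\<dots> = [:pCons c P:] - map_poly (\<lambda>c. [:c:]) (pCons c P)"
    by (simp only: diff_quot_exact) (simp add: map_poly_pCons)
  also have "\<dots> = [:[:0, 1:], -1:] * diff_quot (pCons c P)"
    by (rule diff_quot_exact [symmetric])
  finally show ?thesis
    by (subst (asm) mult_cancel_left) simp
qed

text \<open>Q is the polynomial part of P f. The induction on P changes f: writing z f = f_0 + g
  with g again free of nonpositive powers of 1/z, the remainder for c + z P and f equals c f plus
  the remainder for P and g.\<close>

lemma lser_remainder_nth_nonpos:
  assumes "\<And>k. k \<le> 0 \<Longrightarrow> fls_nth f k = 0" and "m \<le> 0"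
  shows "fls_nth (poly_to_lser P * f - poly_to_lser (phi f (diff_quot P))) m = 0"
  using assms
proof (induction P arbitrary: f)
  case 0
  then show ?case by (simp add: diff_quot_def phi_def)
next
  case (pCons c P)
  define g where "g = fls_X_inv * f - fls_const (fls_nth f 1)"
  have g: "fls_nth g k = (if k \<le> 0 then 0 else fls_nth f (k + 1))" for k
    using pCons.prems(1)[of "k + 1"] by (cases "k = 0") (simp_all add: g_def fls_nth_X_inv_mult)
  have "poly_to_lser (pCons c P) * f
      = fls_const c * f + poly_to_lser P * (fls_const (fls_nth f 1) + g)"
    by (simp add: poly_to_lser_pCons g_def algebra_simps)
  moreover have "phi f (diff_quot (pCons c P)) = smult (fls_nth f 1) P + phi g (diff_quot P)"
    unfolding diff_quot_pCons by (rule phi_pCons) (simp add: g)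
  ultimately have "poly_to_lser (pCons c P) * f - poly_to_lser (phi f (diff_quot (pCons c P)))
      = fls_const c * f + (poly_to_lser P * g - poly_to_lser (phi g (diff_quot P)))"
    by (simp add: poly_to_lser_add poly_to_lser_smult algebra_simps)
  moreover have "fls_nth (poly_to_lser P * g - poly_to_lser (phi g (diff_quot P))) m = 0"
    using pCons.prems(2) by (intro pCons.IH) (simp_all add: g)
  ultimately show ?case
    using pCons.prems by simp
qed

lemma zinv_fps_nth_nonpos:
  assumes "f \<in> zinv_fps" and "k \<le> 0"
  shows "fls_nth f k = 0"
  using assms by (auto simp: zinv_fps_def fls_X_times_conv_shift)

text \<open>Nonpositive indices are covered by the choice of Q. At an index m with 1 \<le> m \<le>
  n, Q contributes nothing, and the coefficient of P f is the residue of z^(m-1) P f, so k = m - 1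
  runs below n.\<close>

lemma ord_inf_remainder_ge:
  assumes f: "f \<in> zinv_fps"
    and orth: "\<And>k. k < n \<Longrightarrow> fls_nth (poly_to_lser ([:0, 1:] ^ k * P) * f) 1 = 0"
  shows "ord_inf (poly_to_lser P * f - poly_to_lser (phi f (diff_quot P))) \<ge> Fin (int n + 1)"
proof -
  let ?g = "poly_to_lser P * f - poly_to_lser (phi f (diff_quot P))"
  have "fls_nth ?g m = 0" if "m < int n + 1" for m
  proof (cases "m \<le> 0")
    case True
    then show ?thesis
      using lser_remainder_nth_nonpos zinv_fps_nth_nonpos[OF f] by blast
  next
    case False
    then have "nat (m - 1) < n" "1 + int (nat (m - 1)) = m"
      using that by auto
    then have "fls_nth (poly_to_lser P * f) m = 0"
      using orth[of "nat (m - 1)"] fls_nth_X_power_poly_mult[of "nat (m - 1)" P f 1] by simp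
    then show ?thesis
      using False by (simp add: poly_to_lser_nth_pos)
  qed
  then have "int n + 1 \<le> fls_subdegree ?g" if "?g \<noteq> 0"
    using that by (intro fls_subdegree_geI) auto
  then show ?thesis
    by (simp add: ord_inf_def)
qed

section \<open>The operator E = d/dz + b/a on polynomials\<close>

definition twisted_deriv ::
  "'a::field poly \<Rightarrow> 'a poly \<Rightarrow> 'a poly fract \<Rightarrow> 'a poly fract" where
  "twisted_deriv a b g = fract_deriv g + mult_op (to_fract b / to_fract a) g"

text \<open>The factor a cancels the denominator of b/a. The resulting map g \<mapsto> (ag)' + bg is
  the formal adjoint of D = -a d/dz + b, which links E to \<open>residue_eq_0\<close>.\<close>

lemma twisted_deriv_to_fract:
  assumes "a \<noteq> 0"
  shows "twisted_deriv a b (to_fract (a * g)) = to_fract (pderiv (a * g) + b * g)"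
proof -
  have "fract_deriv (to_fract p) = to_fract (pderiv p)" for p :: "'a poly"
    using fract_deriv_Fract[of 1 p] by (simp add: to_fract_def)
  then show ?thesis
    using assms by (simp add: twisted_deriv_def mult_op_def flip: to_fract_mult)
      (simp add: field_simps)
qed

text \<open>Each application of E costs one factor a. The factor M survives because the only term of
  the product rule that differentiates it contains a M', again a multiple of M. Here M holds the
  powers of the a_v reserved for later operators.\<close>

lemma twisted_deriv_pow_dvd:
  assumes "a \<noteq> 0" and M: "M dvd a * pderiv M" and "a ^ (n + k) * M dvd p"
  shows "\<exists>q. a ^ k * M dvd q \<and> (twisted_deriv a b ^^ n) (to_fract p) = to_fract q"
  using assms(3)
proof (induction n arbitrary: p)
  case 0
  then show ?case by auto
next
  case (Suc n)
  let ?s = "n + k"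
  obtain g where g: "p = a ^ Suc ?s * M * g"
    using Suc.prems by (auto simp only: add_Suc elim!: dvdE)
  obtain h where h: "a * pderiv M = M * h"
    using M by (elim dvdE)
  have p: "p = a * (a ^ ?s * M * g)"
    by (simp add: g)
  have "pderiv (a ^ Suc ?s) = of_nat (Suc ?s) * a ^ ?s * pderiv a"
    by (simp add: pderiv_power_Suc of_nat_poly del: power_Suc of_nat_Suc)
  then have "pderiv p + b * (a ^ ?s * M * g)
      = of_nat (Suc ?s) * a ^ ?s * pderiv a * M * g + a ^ ?s * (a * pderiv M) * g
        + a ^ Suc ?s * M * pderiv g + b * (a ^ ?s * M * g)"
    unfolding g pderiv_mult by (simp add: algebra_simps)
  also have "\<dots> = a ^ ?s * M * (of_nat (Suc ?s) * pderiv a * g + h * g + a * pderiv g + b * g)"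
    unfolding h by (simp add: algebra_simps)
  finally have "a ^ ?s * M dvd pderiv p + b * (a ^ ?s * M * g)"
    by simp
  from Suc.IH[OF this] show ?case
    using twisted_deriv_to_fract[OF assms(1), of b "a ^ ?s * M * g"]
    by (simp add: funpow_swap1 flip: p)
qed

text \<open>As \<open>E = \<partial> + b/a\<close> satisfies \<open>z\<^sup>k E = E z\<^sup>k - k z\<^sup>k\<^sup>-\<^sup>1\<close>, moving \<open>z\<^sup>k\<close> to the right past \<open>E\<^sup>n\<close>
  always leaves a factor \<open>E\<close> in front when \<open>k < n\<close>.\<close>

lemma twisted_deriv_pow_orthogonal:
  assumes "a \<noteq> 0" and "a ^ n dvd p" and "k < n"
    and "(twisted_deriv a b ^^ n) (to_fract p) = to_fract P"
  shows "\<exists>g. [:0, 1:] ^ k * P = pderiv (a * g) + b * g"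
  using assms(2-)
proof (induction n arbitrary: k P)
  case 0
  then show ?case by simp
next
  case (Suc n)
  \<comment> \<open>One more power of a is available than E^n consumes, hence k = 1: the last E acts
    on a multiple of a.\<close>
  obtain X where X: "a dvd X" "(twisted_deriv a b ^^ n) (to_fract p) = to_fract X"
    using twisted_deriv_pow_dvd[OF assms(1), of 1 n 1 p b] Suc.prems(1) by auto
  then obtain q where q: "X = a * q" by (elim dvdE)
  have "to_fract P = twisted_deriv a b (to_fract (a * q))"
    using Suc.prems(3) X(2) q by simp
  then have P: "P = pderiv (a * q) + b * q"
    using twisted_deriv_to_fract[OF assms(1)] by (metis to_fract_eq_iff)
  show ?case
  proof (cases k)
    case 0
    then show ?thesis using P by auto
  next
    case (Suc m)
    \<comment> \<open>The induction hypothesis is applied to X = E^n p in place of P, with exponent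
      m = k - 1 < n.\<close>
    have "a ^ n dvd p"
      using Suc.prems(1) by (metis dvd_mult_right power_Suc)
    then obtain g where g: "[:0, 1:] ^ m * X = pderiv (a * g) + b * g"
      using Suc.IH[of m X] Suc.prems(2) X(2) Suc by auto
    have "pderiv ([:0, 1:] ^ k :: 'a poly) = of_nat k * [:0, 1:] ^ m"
      using pderiv_power_Suc[of "[:0, 1:] :: 'a poly" m] Suc by (simp add: pderiv_pCons of_nat_poly)
    \<comment> \<open>This is z^k E X = E (z^k X) - k z^(k-1) X. By induction the last term is k E
      (a g), so both terms merge into E of a (z^k q - k g).\<close>
    then have "[:0, 1:] ^ k * P
        = pderiv (a * ([:0, 1:] ^ k * q)) + b * ([:0, 1:] ^ k * q)
          - of_nat k * ([:0, 1:] ^ m * X)"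
      by (simp add: P q pderiv_mult algebra_simps)
    also have "\<dots> = pderiv (a * ([:0, 1:] ^ k * q - of_nat k * g))
        + b * ([:0, 1:] ^ k * q - of_nat k * g)"
      unfolding g by (simp add: pderiv_mult pderiv_diff algebra_simps)
    finally show ?thesis by blast
  qed
qed

text \<open>The logarithmic derivative of the product of the a_v^(m_v) is the sum of m_v a_v'/a_v,
  and multiplying by the product of the a_v clears its denominators. This supplies the hypothesis on
  M in \<open>twisted_deriv_pow_dvd\<close>.\<close>

lemma prod_power_dvd_mult_pderiv:
  assumes "finite S"
  shows "(\<Prod>v\<in>S. as v ^ m v) dvd (\<Prod>v\<in>S. as v) * pderiv (\<Prod>v\<in>S. as v ^ m v)"
  using assms
proof (induction S)
  case empty
  then show ?case by simp
next
  case (insert x S)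
  have "as x ^ m x dvd as x * pderiv (as x ^ m x)"
  proof (cases "m x")
    case (Suc k)
    have "as x * pderiv (as x ^ Suc k) = as x ^ Suc k * smult (of_nat (Suc k)) (pderiv (as x))"
      unfolding pderiv_power_Suc by (simp add: mult_ac del: of_nat_Suc)
    then show ?thesis
      by (simp only: Suc dvd_triv_left)
  qed simp
  then obtain c where c: "as x * pderiv (as x ^ m x) = as x ^ m x * c" by (elim dvdE)
  obtain e where e: "(\<Prod>v\<in>S. as v) * pderiv (\<Prod>v\<in>S. as v ^ m v) = (\<Prod>v\<in>S. as v ^ m v) * e"
    using insert.IH by (elim dvdE)
  have "(\<Prod>v\<in>insert x S. as v) * pderiv (\<Prod>v\<in>insert x S. as v ^ m v)
      = as x * as x ^ m x * ((\<Prod>v\<in>S. as v) * pderiv (\<Prod>v\<in>S. as v ^ m v))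
        + (as x * pderiv (as x ^ m x)) * (\<Prod>v\<in>S. as v) * (\<Prod>v\<in>S. as v ^ m v)"
    using insert by (simp add: pderiv_mult algebra_simps)
  also have "\<dots> = (\<Prod>v\<in>insert x S. as v ^ m v) * (as x * e + c * (\<Prod>v\<in>S. as v))"
    unfolding c e using insert by (simp add: algebra_simps)
  finally show ?case by simp
qed

section \<open>Weighted Rodrigues operators on polynomials\<close>

lemma rodrigues_op_to_fract:
  fixes as :: "nat \<Rightarrow> 'a::field_char_0 poly"
  assumes "\<And>v. v \<in> {1..l} \<Longrightarrow> as v \<noteq> 0" and a: "a = (\<Prod>v=1..l. as v)"
  shows "rodrigues_op l as b n r (to_fract ((\<Prod>v=1..l. as v ^ r v) * G))
    = to_fract [:1 / fact n:] * (twisted_deriv a b ^^ n) (to_fract (a ^ n * G))"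
proof -
  have to_fract_prod: "to_fract (\<Prod>v\<in>S. h v) = (\<Prod>v\<in>S. to_fract (h v))"
    for S :: "nat set" and h :: "nat \<Rightarrow> 'a poly"
    by (induction S rule: infinite_finite_induct) simp_all
  have to_fract_power: "to_fract (p ^ m) = to_fract p ^ m" for p :: "'a poly" and m
    by (induction m) simp_all
  have "to_fract [:1 / fact n:] * of_nat (fact n) = (1 :: 'a poly fract)"
  proof -
    have "of_nat (fact n) = to_fract (of_nat (fact n) :: 'a poly)"
      by (simp add: of_nat_fract to_fract_def)
    then show ?thesis
      by (simp add: of_nat_poly flip: to_fract_mult one_pCons)
  qed
  moreover have "of_nat (fact n) \<noteq> (0 :: 'a poly fract)"
    using calculation by auto
  ultimately have fact: "1 / of_nat (fact n) = (to_fract [:1 / fact n:] :: 'a poly fract)"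
    by (simp add: field_simps)
  \<comment> \<open>The weight a_v^(-r_v) cancels against the factor a_v^(r_v) of the argument, so
    E^n meets only the polynomial a^n G.\<close>
  have "(\<Prod>v=1..l. to_fract (as v) powi (- int (r v))) * to_fract (\<Prod>v=1..l. as v ^ r v)
      = (\<Prod>v=1..l. to_fract (as v) powi (- int (r v)) * to_fract (as v) ^ r v)"
    by (simp add: to_fract_prod to_fract_power prod.distrib)
  also have "\<dots> = 1"
    using assms(1) by (intro prod.neutral) (simp add: power_int_minus)
  finally have cancel: "(\<Prod>v=1..l. to_fract (as v) powi (- int (r v)))
      * to_fract ((\<Prod>v=1..l. as v ^ r v) * G) = to_fract G"
    by (simp flip: mult.assoc)
  show ?thesis
    unfolding rodrigues_op_def Let_def a[symmetric] fact
    by (simp only: o_apply mult_op_def cancel) (simp add: mult_op_def twisted_deriv_def[abs_def] to_fract_power)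
qed

text \<open>The operator uses up the exponents r_v through its weight and the n factors a through
  E^n; the surplus exponents m_v remain for the operators applied afterwards.\<close>

lemma rodrigues_op_dvd:
  fixes as :: "nat \<Rightarrow> 'a::field_char_0 poly"
  assumes nz: "\<And>v. v \<in> {1..l} \<Longrightarrow> as v \<noteq> 0"
    and p: "(\<Prod>v=1..l. as v ^ (r v + m v)) dvd p"
  shows "\<exists>q. (\<Prod>v=1..l. as v ^ m v) dvd q \<and> rodrigues_op l as b n r (to_fract p) = to_fract q"
proof -
  let ?M = "\<Prod>v=1..l. as v ^ m v"
  define a where "a = (\<Prod>v=1..l. as v)"
  have a: "a \<noteq> 0" using nz by (simp add: a_def)
  obtain G where "p = (\<Prod>v=1..l. as v ^ (r v + m v)) * G"
    using p by (elim dvdE)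
  then have G: "p = (\<Prod>v=1..l. as v ^ r v) * (?M * G)"
    by (simp add: power_add prod.distrib mult.assoc)
  have "?M dvd a * pderiv ?M"
    unfolding a_def by (rule prod_power_dvd_mult_pderiv) simp
  then obtain q where q: "?M dvd q"
    "(twisted_deriv a b ^^ n) (to_fract (a ^ n * (?M * G))) = to_fract q"
    using twisted_deriv_pow_dvd[OF a, of ?M n 0 "a ^ n * (?M * G)" b] by (auto simp: mult.assoc)
  have "rodrigues_op l as b n r (to_fract p) = to_fract ([:1 / fact n:] * q)"
    unfolding G by (subst rodrigues_op_to_fract[OF nz a_def], assumption, subst q(2))
      (simp only: to_fract_mult)
  then show ?thesis
    using q(1) dvd_mult by blast
qed

lemma rodrigues_op_residue_eq_0:
  fixes as :: "nat \<Rightarrow> 'a::field_char_0 poly"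
  assumes nz: "\<And>v. v \<in> {1..l} \<Longrightarrow> as v \<noteq> 0" and a: "a = (\<Prod>v=1..l. as v)"
    and p: "(\<Prod>v=1..l. as v ^ r v) dvd p"
    and P: "rodrigues_op l as b n r (to_fract p) = to_fract P"
    and f: "lser_D a b f \<in> range poly_to_lser" and "k < n"
  shows "fls_nth (poly_to_lser ([:0, 1:] ^ k * P) * f) 1 = 0"
proof -
  have a0: "a \<noteq> 0" using nz by (simp add: a)
  obtain G where G: "p = (\<Prod>v=1..l. as v ^ r v) * G"
    using p by (elim dvdE)
  obtain q where q: "(twisted_deriv a b ^^ n) (to_fract (a ^ n * G)) = to_fract q"
    using twisted_deriv_pow_dvd[OF a0, of 1 n 0 "a ^ n * G" b] by auto
  have "to_fract P = to_fract [:1 / fact n:] * to_fract q"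
    using P rodrigues_op_to_fract[OF nz a, of b n r G] unfolding G q by (rule trans[OF sym])
  then have "P = [:1 / fact n:] * q"
    by (simp only: to_fract_eq_iff flip: to_fract_mult)
  moreover obtain g where "[:0, 1:] ^ k * q = pderiv (a * g) + b * g"
    using twisted_deriv_pow_orthogonal[OF a0 _ \<open>k < n\<close> q] by auto
  \<comment> \<open>The scalar 1/n! is absorbed into g, since g \<mapsto> (ag)' + bg is
    K-linear.\<close>
  ultimately have "[:0, 1:] ^ k * P = pderiv (a * smult (1 / fact n) g) + b * smult (1 / fact n) g"
    by (simp add: pderiv_smult flip: smult_add_right)
  then show ?thesis
    by (simp only: residue_eq_0[OF f])
qed

section \<open>Products of commuting Rodrigues operators\<close>

lemma foldr_comp_remove1:
  assumes "x \<in> set xs" and "\<And>y. y \<in> set xs \<Longrightarrow> T x \<circ> T y = T y \<circ> T x"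
  shows "foldr (\<circ>) (map T xs) id = T x \<circ> foldr (\<circ>) (map T (remove1 x xs)) id"
  using assms
proof (induction xs)
  case Nil
  then show ?case by simp
next
  case (Cons y ys)
  show ?case
  proof (cases "x = y")
    case False
    then have "foldr (\<circ>) (map T ys) id = T x \<circ> foldr (\<circ>) (map T (remove1 x ys)) id"
      by (intro Cons.IH) (use Cons.prems in simp_all)
    then have "foldr (\<circ>) (map T (y # ys)) id
        = (T y \<circ> T x) \<circ> foldr (\<circ>) (map T (remove1 x ys)) id"
      by (simp add: comp_assoc)
    \<comment> \<open>\<open>T x\<close> has been brought to the front of the tail and now passes
      the head y.\<close>
    also have "T y \<circ> T x = T x \<circ> T y"
      by (rule Cons.prems(2)[symmetric]) simp
    finally show ?thesis
      using False by (simp add: comp_assoc)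
  qed simp
qed

text \<open>The tail of the list acts first. The induction therefore generalises m: the tail must
  leave the exponents r_j + m, from which the head j then consumes r_j.\<close>

lemma foldr_rodrigues_op_dvd:
  fixes as :: "nat \<Rightarrow> 'a::field_char_0 poly"
  assumes nz: "\<And>v. v \<in> {1..l} \<Longrightarrow> as v \<noteq> 0" and "distinct js"
    and R: "\<And>j. j \<in> set js \<Longrightarrow> R j = rodrigues_op l as (b j) (n j) (r j)"
    and "(\<Prod>v=1..l. as v ^ ((\<Sum>j\<in>set js. r j v) + m v)) dvd F"
  shows "\<exists>q. (\<Prod>v=1..l. as v ^ m v) dvd q
    \<and> foldr (\<circ>) (map R js) id (to_fract F) = to_fract q"
  using assms(2-)
proof (induction js arbitrary: m)
  case Nil
  then show ?case by auto
next
  case (Cons j js)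
  have "(\<Prod>v=1..l. as v ^ ((\<Sum>i\<in>set js. r i v) + (r j v + m v))) dvd F"
    using Cons.prems by (simp add: add_ac)
  then have "\<exists>q. (\<Prod>v=1..l. as v ^ (r j v + m v)) dvd q
      \<and> foldr (\<circ>) (map R js) id (to_fract F) = to_fract q"
    by (intro Cons.IH) (use Cons.prems in simp_all)
  then obtain q where "(\<Prod>v=1..l. as v ^ (r j v + m v)) dvd q"
    "foldr (\<circ>) (map R js) id (to_fract F) = to_fract q"
    by blast
  moreover have "foldr (\<circ>) (map R (j # js)) id (to_fract F)
      = R j (foldr (\<circ>) (map R js) id (to_fract F))"
    by simp
  moreover have "R j = rodrigues_op l as (b j) (n j) (r j)"
    using Cons.prems(2) by simp
  ultimately show ?case
    using rodrigues_op_dvd[of l as "r j" m q "b j" "n j", OF nz] by metis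
qed

theorem theorem4p2:
  fixes l d :: nat
    and as b :: "nat \<Rightarrow> 'a::field_char_0 poly"
    and a :: "'a poly"
    and w :: "nat \<Rightarrow> int"
    and f :: "nat \<Rightarrow> nat \<Rightarrow> 'a fls"
    and n :: "nat \<Rightarrow> nat"
    and r :: "nat \<Rightarrow> nat \<Rightarrow> nat"
    and R :: "nat \<Rightarrow> 'a poly fract \<Rightarrow> 'a poly fract"
    and F :: "'a poly"
  assumes "l \<ge> 1" and "d \<ge> 1"
    and "\<And>v. v \<in> {1..l} \<Longrightarrow> as v \<noteq> 0"
    and a: "a = (\<Prod>v=1..l. as v)"
    and w: "\<And>j. j \<in> {1..d} \<Longrightarrow> w j = D_weight a (b j)"
    and "\<And>j. j \<in> {1..d} \<Longrightarrow> w j \<ge> 0"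
    and "\<And>j. j \<in> {1..d} \<Longrightarrow> condition_C a (b j)"
    and "\<And>j u. j \<in> {1..d} \<Longrightarrow> int u \<le> w j \<Longrightarrow> f j u \<in> zinv_fps"
    and lin_indep:
      "\<And>j c. j \<in> {1..d} \<Longrightarrow> (\<Sum>u\<le>nat (w j). fls_const (c u) * f j u) = 0 \<Longrightarrow>
         \<forall>u\<le>nat (w j). c u = 0"
    and "\<And>j u. j \<in> {1..d} \<Longrightarrow> int u \<le> w j \<Longrightarrow> lser_D a (b j) (f j u) \<in> range poly_to_lser"
    and "\<And>j. j \<in> {1..d} \<Longrightarrow> n j \<ge> 1"
    and R: "\<And>j. j \<in> {1..d} \<Longrightarrow> R j = rodrigues_op l as (b j) (n j) (r j)"
    and commute:
      "\<And>j1 j2. j1 \<in> {1..d} \<Longrightarrow> j2 \<in> {1..d} \<Longrightarrow> R j1 \<circ> R j2 = R j2 \<circ> R j1"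
    and "F \<noteq> 0"
    and "(\<Prod>v=1..l. as v ^ (\<Sum>j=1..d. r j v)) dvd F"
    and "op_prod d R (to_fract F) \<noteq> 0"
  shows "\<exists>P. to_fract P = op_prod d R (to_fract F) \<and>
           (\<forall>j\<in>{1..d}. \<forall>u. int u \<le> w j \<longrightarrow>
              ord_inf (poly_to_lser P * f j u - poly_to_lser (phi (f j u) (diff_quot P)))
                \<ge> Fin (int (n j) + 1)) \<and>
           pade_type_approximant {(j, u). j \<in> {1..d} \<and> int u \<le> w j} (\<lambda>(j, u). n j)
             (\<lambda>(j, u). f j u) P (\<lambda>(j, u). phi (f j u) (diff_quot P))"
proof -
  have nz: "\<And>v. v \<in> {1..l} \<Longrightarrow> as v \<noteq> 0" by fact
  let ?J = "[1..<Suc d]"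
  have J: "set ?J = {1..d}" by auto
  have F: "(\<Prod>v=1..l. as v ^ (\<Sum>j=1..d. r j v)) dvd F" by fact
  \<comment> \<open>Surplus m = 0: the full product uses the whole exponent budget of F and still
    gives a polynomial.\<close>
  have "\<exists>q. (\<Prod>v=1..l. as v ^ 0) dvd q \<and> foldr (\<circ>) (map R ?J) id (to_fract F) = to_fract q"
    by (rule foldr_rodrigues_op_dvd[OF nz _ R]) (use F in \<open>simp_all only: J distinct_upt add_0_right\<close>)
  then obtain P where P: "op_prod d R (to_fract F) = to_fract P"
    by (auto simp: op_prod_def simp del: upt_Suc)
  have ord: "ord_inf (poly_to_lser P * f j u - poly_to_lser (phi (f j u) (diff_quot P)))
      \<ge> Fin (int (n j) + 1)" if j: "j \<in> {1..d}" and u: "int u \<le> w j" for j u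
  proof (rule ord_inf_remainder_ge)
    let ?js = "remove1 j ?J"
    have js: "set ?js = {1..d} - {j}" by (simp only: set_remove1_eq distinct_upt J)
    have sum: "(\<Sum>i\<in>{1..d} - {j}. r i v) + r j v = (\<Sum>i=1..d. r i v)" for v
      using j by (simp add: sum.remove)
    \<comment> \<open>Surplus m = r_j: when all operators except the j-th have acted, exactly the
      exponents needed to cancel the weight of \<open>R j\<close> are still guaranteed.\<close>
    have "\<exists>q. (\<Prod>v=1..l. as v ^ r j v) dvd q
        \<and> foldr (\<circ>) (map R ?js) id (to_fract F) = to_fract q"
      by (rule foldr_rodrigues_op_dvd[OF nz _ R])
        (use F in \<open>simp_all only: sum js distinct_remove1 distinct_upt Diff_iff simp_thms\<close>)
    then obtain q where q: "(\<Prod>v=1..l. as v ^ r j v) dvd q"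
      "foldr (\<circ>) (map R ?js) id (to_fract F) = to_fract q" by blast
    \<comment> \<open>Commutativity makes \<open>R j\<close> the outermost operator, so the single P
      satisfies the orthogonality relations for every j.\<close>
    have "foldr (\<circ>) (map R ?J) id = R j \<circ> foldr (\<circ>) (map R ?js) id"
      by (rule foldr_comp_remove1) (use j commute J in auto)
    then have "rodrigues_op l as (b j) (n j) (r j) (to_fract q) = to_fract P"
      using P q(2) R[OF j] by (simp add: op_prod_def del: upt_Suc)
    moreover have "lser_D a (b j) (f j u) \<in> range poly_to_lser"
      using j u by fact
    ultimately show "fls_nth (poly_to_lser ([:0, 1:] ^ k * P) * f j u) 1 = 0" if "k < n j" for k
      using rodrigues_op_residue_eq_0[OF nz a q(1)] that by blast
    show "f j u \<in> zinv_fps"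
      using j u by fact
  qed
  have "P \<noteq> 0"
    using P \<open>op_prod d R (to_fract F) \<noteq> 0\<close> by auto
  then show ?thesis
    using P ord by (intro exI[of _ P]) (auto simp: pade_type_approximant_def)
qed

end
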